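(* Let $G$ be a unicyclic graph with girth at least $4$, let $Q=\{v\in V(G):\deg(v)=1\}$ and $q=|Q|$. Then $Z_{(1)}(G)$ is determined as follows (degrees are degrees in $G$). (i) $Z_{(1)}(G)=q$ if either there are at least two disjoint pairs of adjacent cycle vertices in which all vertices have degree at least $3$; or there is a cycle vertex of degree at least $4$ such that at least one of its cycle neighbors has degree at least $4$ or both of its cycle neighbors have degree $3$. (ii) $Z_{(1)}(G)=q+2$ if either there are exactly two cycle vertices of degree $3$, these two are adjacent, and all other cycle vertices have degree $2$; or every cycle vertex has degree at most $3$ and every pair of (distinct) cycle vertices of degree $3$ are at distance at least $3$ from each other. (iii) $Z_{(1)}(G)=q+1$ otherwise.
   Context: All graphs are finite, simple and undirected. Let $G$ be a graph, $S\subseteq V(G)$ a set of initially blue vertices (all other vertices white), and $L\subseteq V(G)$ a set of leaks. The leaky color change rule: a blue vertex $b\notin L$ which has exactly one white neighbor $w$ may force $w$ to become blue. $S$ is an $\ell$-leaky forcing set if for every choice of a set $L$ of $\ell$ leaks, repeated application of the rule eventually turns all vertices blue. $Z_{(\ell)}(G)$ is the minimum size of an $\ell$-leaky forcing set of $G$. A unicyclic graph is a connected graph containing exactly one cycle; its girth is the length of that cycle. The vertices of the cycle are called cycle vertices, and the cycle neighbors of a cycle vertex are its two neighbors on the cycle. *)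

theory Defs
  imports "Graph_Theory.Graph_Theory"
begin

text \<open>
  A finite simple undirected graph is a \<open>pair_graph\<close>: a finite vertex set with a symmetric,
  irreflexive adjacency relation. Each edge \<open>uv\<close> is represented by the two arcs \<open>(u, v)\<close> and
  \<open>(v, u)\<close>, so the degree of a vertex is its out-degree, and \<open>connected\<close> is connectivity in the
  usual sense.
\<close>

abbreviation degree :: "'a pair_pre_digraph \<Rightarrow> 'a \<Rightarrow> nat" where
  "degree G v \<equiv> out_degree (with_proj G) v"

definition graph_dist :: "'a pair_pre_digraph \<Rightarrow> 'a \<Rightarrow> 'a \<Rightarrow> ereal" where
  "graph_dist G u v = wf_digraph.\<mu> (with_proj G) (\<lambda>_. 1) u v"

subsection \<open>Leaky forcing\<close>

inductive leaky_force :: "'a pair_pre_digraph \<Rightarrow> 'a set \<Rightarrow> 'a set \<Rightarrow> 'a set \<Rightarrow> bool"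
  for G :: "'a pair_pre_digraph" and L :: "'a set" where
  force: "\<lbrakk>b \<in> B; b \<notin> L; {x. (b, x) \<in> parcs G \<and> x \<notin> B} = {w}\<rbrakk>
    \<Longrightarrow> leaky_force G L B (insert w B)"

definition leaky_forcing_set :: "'a pair_pre_digraph \<Rightarrow> nat \<Rightarrow> 'a set \<Rightarrow> bool" where
  "leaky_forcing_set G l S \<longleftrightarrow> S \<subseteq> pverts G \<and>
     (\<forall>L. L \<subseteq> pverts G \<and> card L = l \<longrightarrow> (leaky_force G L)\<^sup>*\<^sup>* S (pverts G))"

definition leaky_forcing_number :: "'a pair_pre_digraph \<Rightarrow> nat \<Rightarrow> nat" where
  "leaky_forcing_number G l = (LEAST k. \<exists>S. leaky_forcing_set G l S \<and> card S = k)"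

subsection \<open>Unicyclic graphs\<close>

text \<open>
  A cycle of the undirected graph is identified with its set of edges, since its traversals from
  different starting points and in the two directions are different arc walks. The bound on the
  length excludes the closed walks \<open>u, v, u\<close> along a single edge, which the digraph library counts
  as cycles.
\<close>

definition cycle_edge_sets :: "'a pair_pre_digraph \<Rightarrow> 'a set set set" where
  "cycle_edge_sets G =
     {(\<lambda>(u, v). {u, v}) ` set p | p. pre_digraph.cycle (with_proj G) p \<and> length p \<ge> 3}"

definition unicyclic :: "'a pair_pre_digraph \<Rightarrow> bool" where
  "unicyclic G \<longleftrightarrow> connected (with_proj G) \<and> (\<exists>!C. C \<in> cycle_edge_sets G)"

definition the_cycle :: "'a pair_pre_digraph \<Rightarrow> 'a set set" where
  "the_cycle G = (THE C. C \<in> cycle_edge_sets G)"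

definition unicyclic_girth :: "'a pair_pre_digraph \<Rightarrow> nat" where
  "unicyclic_girth G = card (the_cycle G)"

definition cycle_vertices :: "'a pair_pre_digraph \<Rightarrow> 'a set" where
  "cycle_vertices G = \<Union> (the_cycle G)"

definition cycle_neighbors :: "'a pair_pre_digraph \<Rightarrow> 'a \<Rightarrow> 'a set" where
  "cycle_neighbors G v = {w. {v, w} \<in> the_cycle G}"

subsection \<open>The case distinction\<close>

definition two_disjoint_branching_pairs :: "'a pair_pre_digraph \<Rightarrow> bool" where
  "two_disjoint_branching_pairs G \<longleftrightarrow>
     (\<exists>u v x y. {u, v, x, y} \<subseteq> cycle_vertices G \<and>
        (u, v) \<in> parcs G \<and> (x, y) \<in> parcs G \<and> {u, v} \<inter> {x, y} = {} \<and>
        (\<forall>w \<in> {u, v, x, y}. degree G w \<ge> 3))"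

definition heavy_cycle_vertex :: "'a pair_pre_digraph \<Rightarrow> bool" where
  "heavy_cycle_vertex G \<longleftrightarrow>
     (\<exists>v \<in> cycle_vertices G. degree G v \<ge> 4 \<and>
        ((\<exists>w \<in> cycle_neighbors G v. degree G w \<ge> 4) \<or>
         (\<forall>w \<in> cycle_neighbors G v. degree G w = 3)))"

definition single_adjacent_branching_pair :: "'a pair_pre_digraph \<Rightarrow> bool" where
  "single_adjacent_branching_pair G \<longleftrightarrow>
     (\<exists>u v. u \<noteq> v \<and> {w \<in> cycle_vertices G. degree G w = 3} = {u, v} \<and> (u, v) \<in> parcs G \<and>
        (\<forall>w \<in> cycle_vertices G - {u, v}. degree G w = 2))"

definition far_apart_branching :: "'a pair_pre_digraph \<Rightarrow> bool" where
  "far_apart_branching G \<longleftrightarrow>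
     (\<forall>v \<in> cycle_vertices G. degree G v \<le> 3) \<and>
     (\<forall>u \<in> cycle_vertices G. \<forall>v \<in> cycle_vertices G.
        u \<noteq> v \<and> degree G u = 3 \<and> degree G v = 3 \<longrightarrow> graph_dist G u v \<ge> 3)"

end

theory Submission
  imports Defs
begin

text \<open>
  Every leaf belongs to every 1-leaky forcing set, since its only neighbour may leak. The question is
  therefore how many vertices have to be added to the set of leaves. The answer rests on a
  description of what can go wrong. Call a set \<open>W\<close> of cycle vertices an obstruction if it has a
  vertex on every cycle edge and all its vertices have degree two, except possibly one of degree
  three. A set \<open>S\<close> that contains the leaves is a 1-leaky forcing set if and only if it meets every
  obstruction (\<open>leaky_forcing_set_iff\<close>).

  If \<open>S\<close> avoids an obstruction \<open>W\<close>, let the off-cycle neighbour of the vertex of degree three leak.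
  A blue cycle vertex has two white cycle neighbours, and no vertex off the cycle except the leak has
  a neighbour in \<open>W\<close>, so \<open>W\<close> stays white (\<open>obstruction_stalls\<close>).

  Conversely, let the forcing process stop at a set \<open>B\<close> with some vertices still white, and consider
  the subgraph of all edges that have a white end. White vertices have degree at least two in it, as
  leaves are blue, and so has every blue vertex that it contains, except possibly the leak, because a
  blue vertex with a single white neighbour could force. A forest always has two vertices of degree one in
  a component with an edge, hence this subgraph contains a cycle. As \<open>G\<close> has only one cycle, every
  cycle edge has a white end. A subgraph of a unicyclic graph has no more edges than vertices, so
  the average degree is at most two; the leak allows for at most one white vertex of degree three
  and for none of larger degree. Thus the white cycle vertices form an obstruction
  (\<open>stalled_gives_obstruction\<close>). Trees attached to the cycle never have to be examined, because the
  edge count deals with them.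

  What remains is combinatorics on the cycle. The first condition of the theorem says that there is
  no obstruction, the second that every vertex is avoided by some obstruction, and two adjacent
  cycle vertices together always meet all obstructions.
\<close>

section \<open>Cycles in symmetric relations\<close>

definition cyclic_in :: "'a rel \<Rightarrow> 'a list \<Rightarrow> bool" where
  "cyclic_in A xs \<longleftrightarrow> 3 \<le> length xs \<and> distinct xs \<and>
     (\<forall>i < length xs. (xs ! i, xs ! (Suc i mod length xs)) \<in> A)"

definition cyclic_edges :: "'a list \<Rightarrow> 'a set set" where
  "cyclic_edges xs = (\<lambda>i. {xs ! i, xs ! (Suc i mod length xs)}) ` {..<length xs}"

lemma cyclic_in_mono: "cyclic_in A xs \<Longrightarrow> A \<subseteq> B \<Longrightarrow> cyclic_in B xs"
  unfolding cyclic_in_def by blast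

text \<open>
  A longest path cannot be prolonged at its first vertex, so all neighbours of that vertex lie on
  the path; one of them is not the second vertex, and the path closes up there.
\<close>
lemma cycle_if_min_degree_two:
  assumes fin: "finite A" and "sym A" and "irrefl A" and "A \<noteq> {}"
    and deg: "\<And>v. v \<in> Domain A \<Longrightarrow> 2 \<le> card (A `` {v})"
  shows "\<exists>xs. cyclic_in A xs"
proof -
  define P where "P = {xs. xs \<noteq> [] \<and> distinct xs \<and> successively (\<lambda>x y. (x, y) \<in> A) xs
    \<and> set xs \<subseteq> Domain A}"
  have finD: "finite (Domain A)" using fin by (rule finite_Domain)
  obtain a b where "(a, b) \<in> A" using \<open>A \<noteq> {}\<close> by auto
  then have "[a] \<in> P" unfolding P_def by auto
  moreover have "\<forall>xs. xs \<in> P \<longrightarrow> length xs < Suc (card (Domain A))"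
    unfolding P_def using finD by (auto simp: less_Suc_eq_le distinct_card[symmetric] intro!: card_mono)
  ultimately obtain xs where xs: "xs \<in> P" and max: "\<And>ys. ys \<in> P \<Longrightarrow> length ys \<le> length xs"
    using ex_has_greatest_nat[of "\<lambda>xs. xs \<in> P" "[a]" length] by blast
  have dist: "distinct xs" and ne: "xs \<noteq> []"
    and suc: "\<And>i. Suc i < length xs \<Longrightarrow> (xs ! i, xs ! Suc i) \<in> A"
    and dom: "set xs \<subseteq> Domain A"
    using xs unfolding P_def by (auto simp: successively_conv_nth)
  have nbr: "z \<in> set xs" if z: "(xs ! 0, z) \<in> A" for z
  proof (rule ccontr)
    assume "z \<notin> set xs"
    moreover have "(z, xs ! 0) \<in> A" using z \<open>sym A\<close> by (blast dest: symD)
    ultimately have "z # xs \<in> P" using xs unfolding P_def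
      by (cases xs) auto
    with max[of "z # xs"] show False by simp
  qed
  have "2 \<le> card (A `` {xs ! 0})" using deg dom ne by (metis length_greater_0_conv nth_mem subsetD)
  moreover have "card (A `` {xs ! 0}) \<le> 1" if "A `` {xs ! 0} \<subseteq> {xs ! 1}"
    using card_mono[OF _ that] by simp
  ultimately obtain z where z: "(xs ! 0, z) \<in> A" "z \<noteq> xs ! 1" by fastforce
  then obtain k where k: "k < length xs" "z = xs ! k" using nbr by (metis in_set_conv_nth)
  have "k \<noteq> 0" using z k \<open>irrefl A\<close> unfolding irrefl_def by (cases k) auto
  moreover have "k \<noteq> 1" using z k by auto
  ultimately have k2: "2 \<le> k" by simp
  have "(xs ! k, xs ! 0) \<in> A" using z k \<open>sym A\<close> by (blast dest: symD)
  then have "(take (Suc k) xs ! i, take (Suc k) xs ! (Suc i mod Suc k)) \<in> A" if "i < Suc k" for i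
    using that k suc by (cases "i = k") simp_all
  then have "cyclic_in A (take (Suc k) xs)"
    unfolding cyclic_in_def using k k2 dist by (simp add: min_absorb2)
  then show ?thesis ..
qed

text \<open>
  The forest bound: a nonempty forest on \<open>n\<close> non-isolated vertices has at most \<open>n - 1\<close> edges,
  that is \<open>2 * n - 2\<close> arcs. Removing a vertex of degree one takes away two arcs and at least one
  non-isolated vertex, so the inequality persists; once there is no such vertex, the longest path
  argument applies.
\<close>
lemma cycle_if_many_arcs:
  assumes "finite A" and "sym A" and "irrefl A" and "A \<noteq> {}"
    and "2 * card (Domain A) \<le> card A + 1"
  shows "\<exists>xs. cyclic_in A xs"
  using assms
proof (induction "card A" arbitrary: A rule: less_induct)
  case less
  show ?case
  proof (cases "\<exists>v \<in> Domain A. card (A `` {v}) < 2")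
    case True
    then obtain v where v: "v \<in> Domain A" "card (A `` {v}) < 2" by blast
    have fI: "finite (A `` {v})" using less.prems(1) by (simp add: finite_Image)
    have "card (A `` {v}) \<noteq> 0" using v fI by auto
    then have "card (A `` {v}) = 1" using v by simp
    then obtain u where u: "A `` {v} = {u}" by (auto simp: card_1_singleton_iff)
    then have vu: "(v, u) \<in> A" by auto
    then have uv: "(u, v) \<in> A" using less.prems(2) by (blast dest: symD)
    have "u \<noteq> v" using vu less.prems(3) by (auto simp: irrefl_def)
    define A' where "A' = A - {(v, u), (u, v)}"
    have c2: "card {(v, u), (u, v)} = 2" using \<open>u \<noteq> v\<close> by simp
    have sub2: "{(v, u), (u, v)} \<subseteq> A" using vu uv by simp
    have cA: "card A' + 2 = card A"
      using card_Diff_subset[OF _ sub2] c2 card_mono[OF less.prems(1) sub2]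
      unfolding A'_def by simp
    have "Domain A' \<subseteq> Domain A - {v}" using u unfolding A'_def by auto
    then have "card (Domain A') \<le> card (Domain A - {v})"
      using less.prems(1) by (intro card_mono) (auto simp: finite_Domain)
    also have "\<dots> + 1 = card (Domain A)"
      using card_Suc_Diff1[OF finite_Domain[OF less.prems(1)] v(1)] by simp
    finally have cD: "card (Domain A') + 1 \<le> card (Domain A)" by simp
    have "A' \<noteq> {}"
    proof
      assume "A' = {}"
      then have "A = {(v, u), (u, v)}" using sub2 unfolding A'_def by auto
      moreover from this have "Domain A = {v, u}" by auto
      ultimately have "card A = 2" "card (Domain A) = 2" using \<open>u \<noteq> v\<close> c2 by simp_all
      with less.prems(5) show False by simp
    qed
    moreover have "sym A'" using less.prems(2) unfolding A'_def sym_def by blast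
    moreover have "irrefl A'" using less.prems(3) unfolding A'_def irrefl_def by blast
    moreover have "finite A'" using less.prems(1) unfolding A'_def by blast
    moreover have "2 * card (Domain A') \<le> card A' + 1" using less.prems(5) cA cD by linarith
    ultimately obtain xs where "cyclic_in A' xs" using less.hyps[of A'] cA by auto
    then show ?thesis using cyclic_in_mono[of A' xs A] unfolding A'_def by auto
  next
    case False
    then show ?thesis
      using less.prems by (intro cycle_if_min_degree_two) (auto simp: not_less)
  qed
qed

section \<open>Cycles as vertex lists\<close>

lemma pcas_upt:
  "i \<le> k \<Longrightarrow> pcas (f i) (map (\<lambda>j. (f j, f (Suc j))) [i..<k]) (f k)"
proof (induction "k - i" arbitrary: i)
  case (Suc d)
  then have "i < k" by simp
  then show ?case using Suc by (simp add: upt_conv_Cons)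
qed auto

context pair_graph
begin

lemma degree_eq: "degree G v = card (parcs G `` {v})"
proof -
  have "out_arcs (with_proj G) v = Pair v ` (parcs G `` {v})"
    by (auto simp: out_arcs_def)
  then show ?thesis unfolding out_degree_def by (simp add: card_image inj_on_def)
qed

lemma cyclic_edges_in_cycle_edge_sets:
  assumes "cyclic_in (parcs G) xs"
  shows "cyclic_edges xs \<in> cycle_edge_sets G"
proof -
  define n where "n = length xs"
  define f where "f j = xs ! (j mod n)" for j
  define p where "p = map (\<lambda>j. (f j, f (Suc j))) [0..<n]"
  have n3: "3 \<le> n" and dist: "distinct xs"
    and arc: "\<And>i. i < n \<Longrightarrow> (xs ! i, xs ! (Suc i mod n)) \<in> parcs G"
    using assms unfolding cyclic_in_def n_def by auto
  have fst: "map fst p = xs"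
    unfolding p_def f_def by (rule nth_equalityI) (simp_all add: n_def[symmetric])
  have setp: "set p \<subseteq> parcs G" using arc unfolding p_def f_def by auto
  have p_ne: "p \<noteq> []" using n3 unfolding p_def by simp
  have "pcas (f 0) p (f n)" unfolding p_def by (rule pcas_upt) simp
  moreover have "f n = f 0" unfolding f_def by simp
  ultimately have cas: "pcas (f 0) p (f 0)" by simp
  have "f 0 \<in> pverts G" using arc[of 0] n3 unfolding f_def by (auto intro: in_arcsD1)
  then have aw: "awalk (f 0) p (f 0)" using setp cas unfolding awalk_def by simp
  \<comment> \<open>Listing the vertices of the closed walk by tails or by heads gives the same multiset.\<close>
  have v1: "pawalk_verts (f 0) p = f 0 # map snd p"
    using awalk_verts_conv'[of "f 0" p "f 0"] cas p_ne by (cases p) auto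
  have v2: "pawalk_verts (f 0) p = map fst p @ [snd (last p)]"
    using awalk_verts_conv[of "f 0" p] p_ne by simp
  have "snd (last p) = f 0"
    using \<open>f n = f 0\<close> n3 unfolding p_def by (simp add: last_map)
  then have "mset (f 0 # map snd p) = mset (map fst p @ [f 0])" using v1 v2 by simp
  then have "mset (map snd p) = mset (map fst p)" by simp
  then have "distinct (map snd p)" using fst dist by (metis mset_eq_imp_distinct_iff)
  then have "cycle p" unfolding cycle_def using aw v1 p_ne by auto
  moreover have "(\<lambda>(u, v). {u, v}) ` set p = cyclic_edges xs"
    unfolding p_def cyclic_edges_def f_def n_def by (auto simp: image_image)
  moreover have "3 \<le> length p" using n3 unfolding p_def by simp
  ultimately show ?thesis
    unfolding cycle_edge_sets_def mem_Collect_eq by (intro exI[of _ p]) simp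
qed

lemma cycle_edge_sets_cyclic_edges:
  assumes "E \<in> cycle_edge_sets G"
  shows "\<exists>xs. cyclic_in (parcs G) xs \<and> E = cyclic_edges xs"
proof -
  obtain p where E: "E = (\<lambda>(u, v). {u, v}) ` set p" and cyc: "cycle p" and n3: "3 \<le> length p"
    using assms unfolding cycle_edge_sets_def by auto
  then obtain u where aw: "awalk u p u" and dist: "distinct (tl (pawalk_verts u p))" and ne: "p \<noteq> []"
    unfolding cycle_def by auto
  have cas: "pcas u p u" and setp: "set p \<subseteq> parcs G" using aw unfolding awalk_def by auto
  have v1: "pawalk_verts u p = u # map snd p"
    using awalk_verts_conv'[of u p u] cas ne by (cases p) auto
  have v2: "pawalk_verts u p = map fst p @ [snd (last p)]"
    using awalk_verts_conv[of u p] ne by simp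
  have eq: "u # map snd p = map fst p @ [snd (last p)]" using v1 v2 by simp
  have last: "snd (last p) = u" using cas awlast_if_cas[of u p u] v2 by simp
  define xs where "xs = map fst p"
  have "mset (u # map snd p) = mset (map fst p @ [u])" using eq last by simp
  then have "mset (map snd p) = mset (map fst p)" by simp
  moreover have "distinct (map snd p)" using dist v1 by simp
  ultimately have dxs: "distinct xs" unfolding xs_def by (metis mset_eq_imp_distinct_iff)
  have nth: "p ! i = (xs ! i, xs ! (Suc i mod length xs))" if i: "i < length p" for i
  proof (cases "Suc i < length p")
    case True
    then have "snd (p ! i) = xs ! Suc i"
      using arg_cong[OF eq, of "\<lambda>l. l ! Suc i"] unfolding xs_def by (simp add: nth_append)
    then show ?thesis using True i unfolding xs_def by (simp add: prod_eq_iff)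
  next
    case False
    then have "Suc i = length p" using i by simp
    then have "snd (p ! i) = u" using last ne by (metis diff_Suc_1 last_conv_nth)
    moreover have "xs ! 0 = u"
      using arg_cong[OF eq, of "\<lambda>l. l ! 0"] ne unfolding xs_def by (simp add: nth_append)
    ultimately show ?thesis using \<open>Suc i = length p\<close> i unfolding xs_def by (simp add: prod_eq_iff)
  qed
  have len: "length xs = length p" unfolding xs_def by simp
  have "cyclic_in (parcs G) xs"
    unfolding cyclic_in_def using n3 dxs setp len nth by (metis nth_mem subsetD)
  moreover have "E = cyclic_edges xs"
  proof -
    have "set p = (!) p ` {..<length p}" by (auto simp: set_conv_nth)
    then show ?thesis unfolding E cyclic_edges_def len
      using nth len by (simp add: image_image cong: image_cong_simp)
  qed
  ultimately show ?thesis by blast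
qed

end

section \<open>Stalled colourings\<close>

definition stalled :: "'a pair_pre_digraph \<Rightarrow> 'a set \<Rightarrow> 'a set \<Rightarrow> bool" where
  "stalled G L B \<longleftrightarrow> (\<forall>b \<in> B - L. \<forall>w. {x. (b, x) \<in> parcs G \<and> x \<notin> B} \<noteq> {w})"

text \<open>
  Forcing is monotone: a vertex that can force \<open>w\<close> can still do so when more vertices are blue,
  unless \<open>w\<close> is blue already.
\<close>
lemma leaky_force_stays_in_stalled:
  assumes "(leaky_force G L)\<^sup>*\<^sup>* S T" and "S \<subseteq> B" and "stalled G L B"
  shows "T \<subseteq> B"
  using assms(1)
proof induction
  case base
  show ?case by fact
next
  case (step T U)
  from step.hyps(2) show ?case
  proof cases
    case (force b w)
    have "w \<in> B"
    proof (rule ccontr)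
      assume "w \<notin> B"
      then have "{x. (b, x) \<in> parcs G \<and> x \<notin> B} = {w}" using force(4) step.IH by blast
      moreover have "b \<in> B - L" using force step.IH by blast
      ultimately show False using assms(3) unfolding stalled_def by blast
    qed
    then show ?thesis using force step.IH by simp
  qed
qed

lemma (in pair_graph) leaky_force_reaches_stalled:
  assumes "S \<subseteq> pverts G"
  shows "\<exists>B. (leaky_force G L)\<^sup>*\<^sup>* S B \<and> S \<subseteq> B \<and> B \<subseteq> pverts G \<and> stalled G L B"
  using assms
proof (induction "card (pverts G - S)" arbitrary: S rule: less_induct)
  case less
  show ?case
  proof (cases "stalled G L S")
    case True
    then show ?thesis using less.prems by blast
  next
    case False
    then obtain b w where b: "b \<in> S" "b \<notin> L" and w: "{x. (b, x) \<in> parcs G \<and> x \<notin> S} = {w}"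
      unfolding stalled_def by blast
    then have step: "leaky_force G L S (insert w S)" by (rule leaky_force.force)
    have wV: "w \<in> pverts G" "w \<notin> S" using w by (auto dest: in_arcsD2)
    then have "card (pverts G - insert w S) < card (pverts G - S)"
      using pair_finite_verts by (intro psubset_card_mono) auto
    then obtain B where "(leaky_force G L)\<^sup>*\<^sup>* (insert w S) B" "insert w S \<subseteq> B"
      "B \<subseteq> pverts G" "stalled G L B"
      using less.hyps[of "insert w S"] less.prems wV by blast
    then show ?thesis using step by (meson converse_rtranclp_into_rtranclp insert_subset)
  qed
qed

section \<open>The unique cycle\<close>

locale unicyclic_girth_ge_4 = pair_graph G for G :: "'a pair_pre_digraph" (structure) +
  assumes unicyclic: "unicyclic G"
    and girth: "unicyclic_girth G \<ge> 4"
begin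

lemma the_cycle_unique: "E \<in> cycle_edge_sets G \<Longrightarrow> E = the_cycle G"
  using unicyclic unfolding unicyclic_def the_cycle_def by (metis the_equality)

lemma obtain_cycle:
  obtains xs where "cyclic_in (parcs G) xs" "the_cycle G = cyclic_edges xs"
proof -
  have "the_cycle G \<in> cycle_edge_sets G"
    using unicyclic theI'[of "\<lambda>C. C \<in> cycle_edge_sets G"]
    unfolding unicyclic_def the_cycle_def by blast
  then show ?thesis using cycle_edge_sets_cyclic_edges that by blast
qed

text \<open>
  The bound on the number of arcs forces a cycle inside \<open>A\<close>, and there is only one cycle.
\<close>
lemma cycle_in_many_arcs:
  assumes sub: "A \<subseteq> parcs G" and sym: "sym A" and "A \<noteq> {}"
    and "2 * card (Domain A) \<le> card A + 1" and uv: "{u, v} \<in> the_cycle G"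
  shows "(u, v) \<in> A"
proof -
  have "irrefl A" using sub no_loops' by (auto simp: irrefl_def)
  moreover have "finite A" using sub pair_finite_arcs by (rule finite_subset)
  ultimately obtain xs where xs: "cyclic_in A xs" using cycle_if_many_arcs[of A] assms by blast
  then have "cyclic_edges xs \<in> cycle_edge_sets G"
    using cyclic_edges_in_cycle_edge_sets cyclic_in_mono sub by blast
  then have "{u, v} \<in> cyclic_edges xs" using the_cycle_unique uv by blast
  then obtain i where i: "i < length xs" "{u, v} = {xs ! i, xs ! (Suc i mod length xs)}"
    unfolding cyclic_edges_def by auto
  then have "(xs ! i, xs ! (Suc i mod length xs)) \<in> A" using xs unfolding cyclic_in_def by blast
  then show ?thesis using i(2) sym by (auto simp: doubleton_eq_iff dest: symD)
qed

definition cycle_arcs :: "'a rel" where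
  "cycle_arcs = {(u, v). {u, v} \<in> the_cycle G}"

lemma cycle_arcs_iff: "(u, v) \<in> cycle_arcs \<longleftrightarrow> {u, v} \<in> the_cycle G"
  unfolding cycle_arcs_def by simp

lemma sym_cycle_arcs: "sym cycle_arcs"
  unfolding sym_def cycle_arcs_iff by (simp add: insert_commute)

lemma cycle_arcs_subset: "cycle_arcs \<subseteq> parcs G"
proof -
  obtain xs where xs: "cyclic_in (parcs G) xs" "the_cycle G = cyclic_edges xs" by (rule obtain_cycle)
  have "(u, v) \<in> parcs G" if uv: "{u, v} \<in> the_cycle G" for u v
  proof -
    obtain i where "i < length xs" "{u, v} = {xs ! i, xs ! (Suc i mod length xs)}"
      using uv xs(2) unfolding cyclic_edges_def by auto
    moreover from this have "(xs ! i, xs ! (Suc i mod length xs)) \<in> parcs G"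
      using xs(1) unfolding cyclic_in_def by blast
    ultimately show ?thesis by (metis arcs_symmetric doubleton_eq_iff)
  qed
  then show ?thesis unfolding cycle_arcs_def by blast
qed

lemma cycle_edge_arc: "{u, v} \<in> the_cycle G \<Longrightarrow> (u, v) \<in> parcs G"
  using cycle_arcs_subset cycle_arcs_iff by blast

lemma cycle_edge_distinct: "{u, v} \<in> the_cycle G \<Longrightarrow> u \<noteq> v"
  using cycle_edge_arc no_loops' by blast

lemma cycle_edge_vertices: "{u, v} \<in> the_cycle G \<Longrightarrow> u \<in> cycle_vertices G \<and> v \<in> cycle_vertices G"
  unfolding cycle_vertices_def by blast

lemma ex_cycle_edge: "\<exists>u v. {u, v} \<in> the_cycle G"
proof -
  obtain xs where xs: "cyclic_in (parcs G) xs" "the_cycle G = cyclic_edges xs" by (rule obtain_cycle)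
  then have "0 < length xs" unfolding cyclic_in_def by linarith
  then show ?thesis using xs(2) unfolding cyclic_edges_def by blast
qed

lemma card_cycle_neighbors:
  assumes "v \<in> cycle_vertices G"
  shows "card (cycle_neighbors G v) = 2"
proof -
  obtain xs where xs: "cyclic_in (parcs G) xs" and C: "the_cycle G = cyclic_edges xs"
    by (rule obtain_cycle)
  define n where "n = length xs"
  have n3: "3 \<le> n" and dist: "distinct xs" using xs unfolding cyclic_in_def n_def by auto
  have C': "the_cycle G = (\<lambda>i. {xs ! i, xs ! (Suc i mod n)}) ` {..<n}"
    using C unfolding cyclic_edges_def n_def .
  have eq: "xs ! i = xs ! j \<longleftrightarrow> i = j" if "i < n" "j < n" for i j
    using that dist unfolding n_def by (simp add: nth_eq_iff_index_eq)
  have "\<exists>k < n. v = xs ! k"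
  proof -
    obtain i where "i < n" "v = xs ! i \<or> v = xs ! (Suc i mod n)"
      using assms unfolding cycle_vertices_def C' by auto
    moreover have "Suc i mod n < n" using n3 by simp
    ultimately show ?thesis by blast
  qed
  then obtain k where k: "k < n" "v = xs ! k" by blast
  define j where "j = (if k = 0 then n - 1 else k - 1)"
  have j: "j < n" "Suc j mod n = k" using k n3 unfolding j_def by auto
  have pred: "i = j" if "i < n" "Suc i mod n = k" for i
    using that k n3 unfolding j_def by (auto simp: mod_Suc split: if_splits)
  have "cycle_neighbors G v = {xs ! (Suc k mod n), xs ! j}"
  proof (intro equalityI subsetI)
    fix w assume "w \<in> cycle_neighbors G v"
    then obtain i where i: "i < n" "{v, w} = {xs ! i, xs ! (Suc i mod n)}"
      unfolding cycle_neighbors_def C' by auto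
    then consider "v = xs ! i" "w = xs ! (Suc i mod n)" | "v = xs ! (Suc i mod n)" "w = xs ! i"
      by (auto simp: doubleton_eq_iff)
    then show "w \<in> {xs ! (Suc k mod n), xs ! j}"
    proof cases
      case 1
      moreover have "i = k" using 1(1) k(2) eq[OF i(1) k(1)] by simp
      ultimately show ?thesis by simp
    next
      case 2
      have "Suc i mod n < n" using n3 by simp
      then have "Suc i mod n = k" using 2(1) k(2) eq[OF _ k(1)] by metis
      then show ?thesis using pred[OF i(1)] 2(2) by simp
    qed
  next
    fix w assume "w \<in> {xs ! (Suc k mod n), xs ! j}"
    moreover have "{v, xs ! (Suc k mod n)} \<in> the_cycle G" using k unfolding C' by blast
    moreover have "{v, xs ! j} \<in> the_cycle G"
    proof -
      have "{xs ! j, xs ! (Suc j mod n)} \<in> the_cycle G" using j(1) unfolding C' by blast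
      then show ?thesis using j(2) k(2) by (simp add: insert_commute)
    qed
    ultimately show "w \<in> cycle_neighbors G v" unfolding cycle_neighbors_def by blast
  qed
  moreover have "Suc k mod n \<noteq> j"
    using k n3 unfolding j_def by (auto simp: mod_Suc split: if_splits)
  ultimately show ?thesis using eq[of "Suc k mod n" j] j n3 by simp
qed

lemma cycle_arcs_Image: "cycle_arcs `` {v} = cycle_neighbors G v"
  unfolding cycle_neighbors_def cycle_arcs_def by auto

lemma Domain_cycle_arcs: "Domain cycle_arcs = cycle_vertices G"
proof (intro equalityI subsetI)
  fix v assume "v \<in> cycle_vertices G"
  then have "cycle_arcs `` {v} \<noteq> {}"
    using card_cycle_neighbors unfolding cycle_arcs_Image by fastforce
  then show "v \<in> Domain cycle_arcs" by blast
next
  fix v assume "v \<in> Domain cycle_arcs"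
  then obtain w where "{v, w} \<in> the_cycle G" unfolding cycle_arcs_def by auto
  then show "v \<in> cycle_vertices G" using cycle_edge_vertices by blast
qed

lemma finite_cycle_arcs: "finite cycle_arcs"
  using cycle_arcs_subset pair_finite_arcs by (rule finite_subset)

lemma finite_cycle_vertices: "finite (cycle_vertices G)"
  using finite_Domain[OF finite_cycle_arcs] unfolding Domain_cycle_arcs .

lemma cycle_vertices_subset: "cycle_vertices G \<subseteq> pverts G"
proof
  fix v assume "v \<in> cycle_vertices G"
  then obtain w where "(v, w) \<in> cycle_arcs" unfolding Domain_cycle_arcs[symmetric] by blast
  then show "v \<in> pverts G" using cycle_arcs_subset in_arcsD1 by blast
qed

lemma card_cycle_arcs: "card cycle_arcs = 2 * card (cycle_vertices G)"
proof -
  have "cycle_arcs = Sigma (cycle_vertices G) (cycle_neighbors G)"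
    unfolding Domain_cycle_arcs[symmetric] cycle_arcs_Image[symmetric] by auto
  also have "card \<dots> = (\<Sum>v \<in> cycle_vertices G. card (cycle_neighbors G v))"
    using finite_cycle_vertices finite_cycle_arcs
    by (simp add: cycle_arcs_Image[symmetric] finite_Image)
  also have "\<dots> = 2 * card (cycle_vertices G)" using card_cycle_neighbors by simp
  finally show ?thesis .
qed

text \<open>
  Without the two arcs of one cycle edge, \<open>A\<close> contains no cycle and the forest bound applies.
\<close>
lemma card_arcs_le:
  assumes "A \<subseteq> parcs G" and "sym A"
  shows "card A \<le> 2 * card (Domain A)"
proof -
  have fin: "finite A" using assms(1) pair_finite_arcs by (rule finite_subset)
  obtain u v where uv: "{u, v} \<in> the_cycle G" using ex_cycle_edge by blast
  define A' where "A' = A - {(u, v), (v, u)}"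
  have "card A - card {(u, v), (v, u)} \<le> card A'"
    unfolding A'_def by (rule diff_card_le_card_Diff) simp
  moreover have "card {(u, v), (v, u)} \<le> 2" by (cases "u = v") simp_all
  ultimately have cA: "card A \<le> card A' + 2" by linarith
  show ?thesis
  proof (cases "A' = {}")
    case True
    then have "card A \<le> 2" using cA by simp
    moreover have "card (Domain A) \<noteq> 0" if "A \<noteq> {}"
      using that finite_Domain[OF fin] by (simp add: Domain_empty_iff)
    ultimately show ?thesis by (cases "A = {}") simp_all
  next
    case False
    have "sym A'" using assms(2) unfolding A'_def sym_def by blast
    moreover have "A' \<subseteq> parcs G" "(u, v) \<notin> A'" using assms(1) unfolding A'_def by auto
    ultimately have "\<not> 2 * card (Domain A') \<le> card A' + 1"
      using cycle_in_many_arcs[OF _ _ False _ uv] by metis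
    moreover have "card (Domain A') \<le> card (Domain A)"
      unfolding A'_def by (intro card_mono Domain_mono finite_Domain fin Diff_subset)
    ultimately show ?thesis using cA by linarith
  qed
qed

text \<open>
  Adding to the cycle a chord, or a path of two edges with a new middle vertex, would
  leave more edges than vertices.
\<close>
lemma chordless:
  assumes "u \<in> cycle_vertices G" "v \<in> cycle_vertices G" "(u, v) \<in> parcs G"
  shows "{u, v} \<in> the_cycle G"
proof (rule ccontr)
  assume no: "{u, v} \<notin> the_cycle G"
  define A where "A = {(u, v), (v, u)} \<union> cycle_arcs"
  have "u \<noteq> v" using assms(3) no_loops' by blast
  have no': "{v, u} \<notin> the_cycle G" using no by (simp add: insert_commute)
  have "A \<subseteq> parcs G" using assms(3) arcs_symmetric cycle_arcs_subset unfolding A_def by blast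
  moreover have "sym A" unfolding A_def
    by (intro sym_Un sym_cycle_arcs) (simp add: sym_def)
  ultimately have "card A \<le> 2 * card (Domain A)" by (rule card_arcs_le)
  moreover have "Domain A = cycle_vertices G"
    using assms(1,2) unfolding A_def Domain_Un_eq Domain_cycle_arcs by auto
  then have "card (Domain A) = card (cycle_vertices G)" by (rule arg_cong)
  moreover have "card A = card {(u, v), (v, u)} + card cycle_arcs"
    unfolding A_def using finite_cycle_arcs no no' by (intro card_Un_disjoint) (simp_all add: cycle_arcs_iff)
  moreover have "card {(u, v), (v, u)} = 2" using \<open>u \<noteq> v\<close> by simp
  ultimately show False using card_cycle_arcs by linarith
qed

lemma common_neighbor_on_cycle:
  assumes "u \<in> cycle_vertices G" "v \<in> cycle_vertices G" "u \<noteq> v"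
    and "(u, x) \<in> parcs G" "(x, v) \<in> parcs G"
  shows "x \<in> cycle_vertices G"
proof (rule ccontr)
  assume no: "x \<notin> cycle_vertices G"
  define P where "P = {(u, x), (x, u), (x, v), (v, x)}"
  define A where "A = P \<union> cycle_arcs"
  have "P \<subseteq> parcs G" using assms(4,5) arcs_symmetric unfolding P_def by blast
  then have "A \<subseteq> parcs G" using cycle_arcs_subset unfolding A_def by blast
  moreover have "sym A" unfolding A_def P_def
    by (intro sym_Un sym_cycle_arcs) (auto simp: sym_def)
  ultimately have "card A \<le> 2 * card (Domain A)" by (rule card_arcs_le)
  moreover have "Domain A = insert x (cycle_vertices G)"
    using assms(1,2) unfolding A_def P_def Domain_Un_eq Domain_cycle_arcs by auto
  then have "card (Domain A) = card (cycle_vertices G) + 1"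
    using no finite_cycle_vertices by simp
  moreover have "card A = card P + card cycle_arcs"
  proof -
    have "P \<inter> cycle_arcs = {}"
      using no cycle_edge_vertices unfolding P_def cycle_arcs_def by blast
    then show ?thesis
      unfolding A_def using finite_cycle_arcs by (intro card_Un_disjoint) (simp_all add: P_def)
  qed
  moreover have "card P = 4"
  proof -
    have "x \<noteq> u" "x \<noteq> v" using assms(1,2) no by blast+
    then show ?thesis using assms(3) unfolding P_def by simp
  qed
  ultimately show False using card_cycle_arcs by linarith
qed

lemma no_triangle:
  assumes "(u, v) \<in> parcs G" "(v, w) \<in> parcs G" "(w, u) \<in> parcs G"
  shows False
proof -
  have "u \<noteq> v" "v \<noteq> w" "w \<noteq> u" using assms[THEN no_loops'] by simp_all
  moreover have "([u, v, w] ! i, [u, v, w] ! (Suc i mod 3)) \<in> parcs G" if "i < 3" for i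
  proof -
    have "i = 0 \<or> i = 1 \<or> i = 2" using that by linarith
    then show ?thesis using assms by (elim disjE) simp_all
  qed
  moreover have "length [u, v, w] = 3" by simp
  ultimately have "cyclic_in (parcs G) [u, v, w]"
    unfolding cyclic_in_def by (metis distinct_length_2_or_more distinct_singleton order_refl)
  then have "the_cycle G = cyclic_edges [u, v, w]"
    by (rule the_cycle_unique[OF cyclic_edges_in_cycle_edge_sets, symmetric])
  moreover have "card (cyclic_edges [u, v, w]) \<le> card {..<length [u, v, w]}"
    unfolding cyclic_edges_def by (rule card_image_le) (rule finite_lessThan)
  ultimately show False using girth unfolding unicyclic_girth_def by simp
qed

lemma two_le_degree_cycle: "v \<in> cycle_vertices G \<Longrightarrow> 2 \<le> degree G v"
proof -
  assume v: "v \<in> cycle_vertices G"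
  have "cycle_neighbors G v \<subseteq> parcs G `` {v}"
    unfolding cycle_neighbors_def using cycle_edge_arc by blast
  moreover have "finite (parcs G `` {v})" using pair_finite_arcs by (rule finite_Image)
  ultimately have "card (cycle_neighbors G v) \<le> card (parcs G `` {v})" by (intro card_mono)
  then show ?thesis using v unfolding degree_eq by (simp add: card_cycle_neighbors)
qed

lemma one_le_degree:
  assumes "v \<in> pverts G"
  shows "1 \<le> degree G v"
proof -
  obtain c d where c: "{c, d} \<in> the_cycle G" using ex_cycle_edge by blast
  have "\<exists>w. (v, w) \<in> parcs G"
  proof (cases "v = c")
    case True
    then show ?thesis using c cycle_edge_arc by blast
  next
    case False
    have "c \<in> pverts G" using c cycle_edge_vertices cycle_vertices_subset by blast
    moreover have "strongly_connected (with_proj G)"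
      using unicyclic symmetric_connected_imp_strongly_connected sym_arcs
      unfolding unicyclic_def by blast
    ultimately have "v \<rightarrow>\<^sup>*\<^bsub>with_proj G\<^esub> c"
      using assms by (auto simp: strongly_connected_def)
    then show ?thesis using False by (cases rule: converse_reachable_cases) auto
  qed
  then show ?thesis unfolding degree_eq
    using pair_finite_arcs by (auto simp: Suc_le_eq card_gt_0_iff finite_Image)
qed

section \<open>Leaky forcing sets and obstructions\<close>

text \<open>
  A set of cycle vertices that stays white for ever, if it is white at the start and the leak is
  well placed. The vertex \<open>y\<close> is the one whose off-cycle neighbour leaks; a \<open>y\<close> outside \<open>W\<close>
  expresses that all vertices of \<open>W\<close> have degree two.
\<close>
definition obstruction :: "'a set \<Rightarrow> bool" where
  "obstruction W \<longleftrightarrow> W \<subseteq> cycle_vertices G \<and>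
     (\<forall>u v. {u, v} \<in> the_cycle G \<longrightarrow> u \<in> W \<or> v \<in> W) \<and>
     (\<exists>y. \<forall>w \<in> W. degree G w \<le> (if w = y then 3 else 2))"

lemma obstruction_subset: "obstruction W \<Longrightarrow> W \<subseteq> cycle_vertices G"
  unfolding obstruction_def by blast

lemma obstruction_cover:
  "obstruction W \<Longrightarrow> {u, v} \<in> the_cycle G \<Longrightarrow> u \<notin> W \<Longrightarrow> v \<in> W"
  unfolding obstruction_def by blast

lemma obstruction_degree_le: "obstruction W \<Longrightarrow> w \<in> W \<Longrightarrow> degree G w \<le> 3"
  unfolding obstruction_def by (auto split: if_splits intro: order_trans)

lemma obstruction_branching_unique:
  assumes "obstruction W" "v \<in> W" "w \<in> W" "3 \<le> degree G v" "3 \<le> degree G w"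
  shows "v = w"
proof (rule ccontr)
  assume "v \<noteq> w"
  obtain y where y: "\<And>w. w \<in> W \<Longrightarrow> degree G w \<le> (if w = y then 3 else 2)"
    using assms(1) unfolding obstruction_def by blast
  have "v = y" using y[OF assms(2)] assms(4) by (simp split: if_splits)
  moreover have "w = y" using y[OF assms(3)] assms(5) by (simp split: if_splits)
  ultimately show False using \<open>v \<noteq> w\<close> by simp
qed

lemma finite_neighbors: "finite (parcs G `` {v})"
  using pair_finite_arcs by (rule finite_Image)

lemma cycle_neighbors_subset: "cycle_neighbors G v \<subseteq> parcs G `` {v}"
  unfolding cycle_neighbors_def using cycle_edge_arc by blast

lemma neighbors_eq_cycle_neighbors:
  assumes "v \<in> cycle_vertices G" "degree G v \<le> 2"
  shows "parcs G `` {v} = cycle_neighbors G v"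
  using card_seteq[OF finite_neighbors cycle_neighbors_subset, of v] assms
  by (simp add: degree_eq card_cycle_neighbors)

text \<open>
  All vertices outside \<open>W\<close> are blue. A blue cycle vertex has two white neighbours, namely its cycle
  neighbours, so it cannot force. No vertex off the cycle sees a vertex of \<open>W\<close>, except a single
  neighbour of \<open>y\<close>, and the leak is put there.
\<close>
lemma obstruction_stalls:
  assumes W: "obstruction W"
  shows "\<exists>l \<in> pverts G. stalled G {l} (pverts G - W)"
proof -
  obtain y where y: "\<And>w. w \<in> W \<Longrightarrow> degree G w \<le> (if w = y then 3 else 2)"
    using W unfolding obstruction_def by blast
  have WC: "W \<subseteq> cycle_vertices G" using W by (rule obstruction_subset)
  obtain l where l: "l \<in> pverts G" "y \<in> W \<Longrightarrow> parcs G `` {y} \<subseteq> insert l (cycle_neighbors G y)"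
  proof (cases "y \<in> W \<and> \<not> parcs G `` {y} \<subseteq> cycle_neighbors G y")
    case True
    then have yW: "y \<in> W" and "y \<in> cycle_vertices G" using WC by auto
    have "card (parcs G `` {y} - cycle_neighbors G y) = degree G y - 2"
      using card_Diff_subset[OF finite_subset[OF cycle_neighbors_subset finite_neighbors]
          cycle_neighbors_subset, of y] card_cycle_neighbors[OF \<open>y \<in> cycle_vertices G\<close>]
      by (simp add: degree_eq)
    also have "\<dots> \<le> 1" using y[OF yW] by simp
    finally have le1: "card (parcs G `` {y} - cycle_neighbors G y) \<le> 1" .
    obtain l where l: "l \<in> parcs G `` {y} - cycle_neighbors G y" using True by blast
    have "parcs G `` {y} - cycle_neighbors G y \<subseteq> {l}"
    proof
      fix z assume "z \<in> parcs G `` {y} - cycle_neighbors G y"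
      then show "z \<in> {l}"
        using l le1 finite_neighbors by (auto simp: card_le_Suc0_iff_eq)
    qed
    moreover have "l \<in> pverts G" using l in_arcsD2 by blast
    ultimately show ?thesis using that by blast
  next
    case False
    obtain u v where "{u, v} \<in> the_cycle G" using ex_cycle_edge by blast
    then have "u \<in> pverts G" using cycle_edge_vertices cycle_vertices_subset by blast
    then show ?thesis using that False by blast
  qed
  have "stalled G {l} (pverts G - W)"
    unfolding stalled_def
  proof (intro ballI allI notI)
    fix b w
    assume "b \<in> pverts G - W - {l}" and eq: "{x. (b, x) \<in> parcs G \<and> x \<notin> pverts G - W} = {w}"
    then have b: "b \<notin> W" "b \<noteq> l" by auto
    have w: "(b, w) \<in> parcs G" "w \<in> W" using eq in_arcsD2 by blast+
    have "b \<in> cycle_neighbors G w"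
    proof (cases "w = y")
      case True
      then show ?thesis using l(2) w b arcs_symmetric by blast
    next
      case False
      then have "parcs G `` {w} = cycle_neighbors G w"
        using neighbors_eq_cycle_neighbors[of w] y[OF w(2)] w(2) WC by auto
      then show ?thesis using w arcs_symmetric by blast
    qed
    then have bC: "b \<in> cycle_vertices G"
      unfolding cycle_neighbors_def using cycle_edge_vertices by blast
    have "cycle_neighbors G b \<subseteq> {x. (b, x) \<in> parcs G \<and> x \<notin> pverts G - W}"
      unfolding cycle_neighbors_def using obstruction_cover[OF W] b cycle_edge_arc by blast
    then have "card (cycle_neighbors G b) \<le> card {w}"
      unfolding eq by (intro card_mono) simp_all
    then show False using card_cycle_neighbors[OF bC] by simp
  qed
  then show ?thesis using l by blast
qed

text \<open>The neighbour of the leaf may leak, and then nothing can force the leaf.\<close>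
lemma leaf_in_leaky_forcing_set:
  assumes S: "leaky_forcing_set G 1 S" and v: "v \<in> pverts G" "degree G v = 1"
  shows "v \<in> S"
proof (rule ccontr)
  assume "v \<notin> S"
  obtain u where u: "parcs G `` {v} = {u}"
    using v(2) unfolding degree_eq by (auto simp: card_1_singleton_iff)
  then have "u \<in> pverts G" using in_arcsD2 by blast
  have "stalled G {u} (pverts G - {v})"
    unfolding stalled_def
  proof (intro ballI allI notI)
    fix b w
    assume b: "b \<in> pverts G - {v} - {u}"
      and eq: "{x. (b, x) \<in> parcs G \<and> x \<notin> pverts G - {v}} = {w}"
    then have "(b, w) \<in> parcs G" "w = v" using in_arcsD2 by blast+
    then have "b \<in> parcs G `` {v}" using arcs_symmetric by blast
    then show False using u b by blast
  qed
  moreover have "(leaky_force G {u})\<^sup>*\<^sup>* S (pverts G)" "S \<subseteq> pverts G - {v}"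
    using S \<open>u \<in> pverts G\<close> \<open>v \<notin> S\<close> unfolding leaky_forcing_set_def by auto
  ultimately have "pverts G \<subseteq> pverts G - {v}" using leaky_force_stays_in_stalled by blast
  then show False using v(1) by blast
qed

text \<open>
  Let \<open>B\<close> be a stalled set that contains all leaves, and let \<open>A\<close> consist of the arcs with a white
  end. White vertices keep their full degree in \<open>A\<close>, which is at least two because leaves are blue;
  a blue vertex other than the leak meets \<open>A\<close> in no arc or in at least two arcs. So the degrees in
  \<open>A\<close> are at least two with at most one exception, where the degree is one. Hence \<open>A\<close> contains the
  cycle, which says that every cycle edge has a white end. Moreover the number of arcs is at most
  twice the number of vertices, so the degrees of white vertices can exceed two in total by at
  most one, to compensate for the leak.
\<close>
lemma stalled_gives_obstruction:
  assumes B: "B \<subseteq> pverts G" "B \<noteq> pverts G" and st: "stalled G {l} B"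
    and leaves: "{v \<in> pverts G. degree G v = 1} \<subseteq> B"
  shows "obstruction (cycle_vertices G - B)"
proof -
  define A where "A = {(a, b) \<in> parcs G. a \<notin> B \<or> b \<notin> B}"
  have sub: "A \<subseteq> parcs G" unfolding A_def by blast
  have symA: "sym A" unfolding A_def sym_def using arcs_symmetric by blast
  have fin: "finite A" using sub pair_finite_arcs by (rule finite_subset)
  have finD: "finite (Domain A)" using fin by (rule finite_Domain)
  have white_img: "A `` {v} = parcs G `` {v}" if "v \<notin> B" for v
    using that unfolding A_def by auto
  have white_deg: "2 \<le> degree G v" if "v \<in> pverts G" "v \<notin> B" for v
    using one_le_degree[OF that(1)] leaves that by fastforce
  have white_dom: "v \<in> Domain A" if v: "v \<in> pverts G" "v \<notin> B" for v
  proof -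
    have "card (A `` {v}) \<noteq> 0"
      using white_deg[OF v] unfolding white_img[OF v(2)] degree_eq by linarith
    then have "A `` {v} \<noteq> {}" by (metis card.empty)
    then show ?thesis by blast
  qed
  have deg: "2 \<le> card (A `` {v}) + (if v = l then 1 else 0)" if v: "v \<in> Domain A" for v
  proof (cases "v \<in> B")
    case False
    have "v \<in> pverts G" using v sub in_arcsD1 by blast
    then show ?thesis using False white_deg[of v] white_img[of v] by (simp add: degree_eq)
  next
    case True
    then have img: "A `` {v} = {x. (v, x) \<in> parcs G \<and> x \<notin> B}" unfolding A_def by auto
    have "card (A `` {v}) \<noteq> 0" using v fin finite_Image[OF fin, of "{v}"] by auto
    moreover have "card (A `` {v}) \<noteq> 1" if "v \<noteq> l"
      using st that True unfolding stalled_def img by (auto simp: card_1_singleton_iff)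
    ultimately show ?thesis by auto
  qed
  have "card A = (\<Sum>v \<in> Domain A. card (A `` {v}))"
  proof -
    have "A = Sigma (Domain A) (\<lambda>v. A `` {v})" by auto
    then have "card A = card (Sigma (Domain A) (\<lambda>v. A `` {v}))" by (rule arg_cong)
    also have "\<dots> = (\<Sum>v \<in> Domain A. card (A `` {v}))"
      using finD fin by (intro card_SigmaI) (simp_all add: finite_Image)
    finally show ?thesis .
  qed
  moreover have "(\<Sum>v \<in> Domain A. if v = l then 1 else 0) \<le> (1::nat)"
    using finD by (simp add: sum.delta)
  ultimately have sum_le: "(\<Sum>v \<in> Domain A. card (A `` {v}) + (if v = l then 1 else 0)) \<le> card A + 1"
    by (simp add: sum.distrib)
  have "(\<Sum>v \<in> Domain A. 2) \<le> (\<Sum>v \<in> Domain A. card (A `` {v}) + (if v = l then 1 else 0))"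
    using deg by (rule sum_mono)
  then have many: "2 * card (Domain A) \<le> card A + 1" using sum_le by simp
  have "A \<noteq> {}" using white_dom B by blast
  have cover: "u \<notin> B \<or> v \<notin> B" if "{u, v} \<in> the_cycle G" for u v
    using cycle_in_many_arcs[OF sub symA \<open>A \<noteq> {}\<close> many that] unfolding A_def by blast
  \<comment> \<open>Two white vertices of degree three, or one of degree four (the case \<open>u = v\<close>), would make the
    degree sum exceed twice the number of vertices, even if the leak has degree one.\<close>
  have excess: False
    if u: "u \<in> pverts G" "u \<notin> B" and v: "v \<in> pverts G" "v \<notin> B"
      and du: "2 + 1 + of_bool (u = v) \<le> degree G u" and dv: "2 + 1 + of_bool (u = v) \<le> degree G v"
    for u v
  proof -
    have "(\<Sum>x \<in> Domain A. 2 + ((if x = u then 1 else 0) + (if x = v then 1 else 0)))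
        \<le> (\<Sum>x \<in> Domain A. card (A `` {x}) + (if x = l then 1 else 0))"
    proof (rule sum_mono)
      fix x assume x: "x \<in> Domain A"
      consider "x \<noteq> u" "x \<noteq> v" | "x = u" | "x = v" by blast
      then show "2 + ((if x = u then 1 else 0) + (if x = v then 1 else 0))
          \<le> card (A `` {x}) + (if x = l then 1 else 0)"
      proof cases
        case 1
        then show ?thesis using deg[OF x] by simp
      next
        case 2
        then show ?thesis using du white_img[OF u(2)] by (cases "u = v") (simp_all add: degree_eq)
      next
        case 3
        then show ?thesis using dv white_img[OF v(2)] by (cases "u = v") (simp_all add: degree_eq)
      qed
    qed
    moreover have "(\<Sum>x \<in> Domain A. 2 + ((if x = u then 1 else 0) + (if x = v then 1 else 0)))
        = 2 * card (Domain A) + 2"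
      unfolding sum.distrib using finD white_dom[OF u] white_dom[OF v] by (simp add: sum.delta)
    ultimately show False using sum_le card_arcs_le[OF sub symA] by linarith
  qed
  let ?W = "cycle_vertices G - B"
  have WV: "w \<in> pverts G" "w \<notin> B" if "w \<in> ?W" for w
    using that cycle_vertices_subset by auto
  have le3: "degree G w \<le> 3" if "w \<in> ?W" for w
    using excess[OF WV[OF that] WV[OF that]] by force
  have "\<exists>y. \<forall>w \<in> ?W. degree G w \<le> (if w = y then 3 else 2)"
  proof (cases "\<exists>y \<in> ?W. 3 \<le> degree G y")
    case True
    then obtain y where y: "y \<in> ?W" "3 \<le> degree G y" by blast
    have "degree G w \<le> 2" if w: "w \<in> ?W" "w \<noteq> y" for w
    proof (rule ccontr)
      assume "\<not> degree G w \<le> 2"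
      then show False using excess[OF WV[OF w(1)] WV[OF y(1)]] y(2) w(2) by simp
    qed
    then show ?thesis using le3 by auto
  next
    case False
    \<comment> \<open>No vertex has degree three, so every choice of \<open>y\<close> will do.\<close>
    have "degree G w \<le> (if w = undefined then 3 else 2)" if "w \<in> ?W" for w
      using False that by force
    then show ?thesis by blast
  qed
  moreover have "u \<in> ?W \<or> v \<in> ?W" if "{u, v} \<in> the_cycle G" for u v
    using cover[OF that] cycle_edge_vertices[OF that] by blast
  ultimately show ?thesis unfolding obstruction_def by blast
qed

lemma leaky_forcing_set_iff:
  assumes "S \<subseteq> pverts G"
  shows "leaky_forcing_set G 1 S \<longleftrightarrow>
    {v \<in> pverts G. degree G v = 1} \<subseteq> S \<and> (\<forall>W. obstruction W \<longrightarrow> W \<inter> S \<noteq> {})"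
    (is "?force \<longleftrightarrow> ?leaves \<subseteq> S \<and> ?meets")
proof (intro iffI conjI)
  assume force: ?force
  show "?leaves \<subseteq> S" using leaf_in_leaky_forcing_set[OF force] by blast
  show ?meets
  proof (intro allI impI notI)
    fix W assume W: "obstruction W" and "W \<inter> S = {}"
    obtain l where l: "l \<in> pverts G" "stalled G {l} (pverts G - W)"
      using obstruction_stalls[OF W] by blast
    have "S \<subseteq> pverts G - W" using assms \<open>W \<inter> S = {}\<close> by blast
    moreover have "(leaky_force G {l})\<^sup>*\<^sup>* S (pverts G)"
      using force l unfolding leaky_forcing_set_def by simp
    ultimately have "pverts G \<subseteq> pverts G - W"
      using leaky_force_stays_in_stalled l(2) by blast
    moreover obtain u v where "{u, v} \<in> the_cycle G" using ex_cycle_edge by blast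
    then have "\<exists>w. w \<in> W" using obstruction_cover[OF W] by blast
    ultimately show False using obstruction_subset[OF W] cycle_vertices_subset by blast
  qed
next
  assume right: "?leaves \<subseteq> S \<and> ?meets"
  show ?force
    unfolding leaky_forcing_set_def
  proof (intro conjI allI impI)
    fix L assume "L \<subseteq> pverts G \<and> card L = 1"
    then obtain l where L: "L = {l}" by (auto simp: card_1_singleton_iff)
    obtain B where B: "(leaky_force G L)\<^sup>*\<^sup>* S B" "S \<subseteq> B" "B \<subseteq> pverts G" "stalled G {l} B"
      using leaky_force_reaches_stalled[OF assms, of L] unfolding L by blast
    have "B = pverts G"
    proof (rule ccontr)
      assume "B \<noteq> pverts G"
      then have "obstruction (cycle_vertices G - B)"
        using stalled_gives_obstruction B(2-4) right by blast
      then show False using right B(2) by blast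
    qed
    then show "(leaky_force G L)\<^sup>*\<^sup>* S (pverts G)" using B(1) by simp
  qed (rule assms)
qed

section \<open>When obstructions exist\<close>

text \<open>
  Colour blue the set \<open>X\<close> and the branching vertices of the cycle, apart from the at most one vertex
  in \<open>Y\<close>. If no two blue cycle vertices are adjacent, the white ones form an obstruction.
\<close>
lemma ex_obstruction_avoiding:
  assumes Y: "Y \<subseteq> {y}" "y \<in> Y \<Longrightarrow> degree G y \<le> 3" "X \<inter> Y = {}"
    and edge: "\<And>a b. \<lbrakk>{a, b} \<in> the_cycle G; 3 \<le> degree G a \<or> a \<in> X; 3 \<le> degree G b \<or> b \<in> X\<rbrakk>
      \<Longrightarrow> a \<in> Y \<or> b \<in> Y"
  shows "\<exists>W. obstruction W \<and> W \<inter> X = {}"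
proof -
  define W where "W = {w \<in> cycle_vertices G - X. degree G w = 2 \<or> w \<in> Y}"
  have "w \<in> W \<longleftrightarrow> \<not> ((3 \<le> degree G w \<or> w \<in> X) \<and> w \<notin> Y)" if "w \<in> cycle_vertices G" for w
    using two_le_degree_cycle[OF that] that Y(3) unfolding W_def by auto
  then have "a \<in> W \<or> b \<in> W" if "{a, b} \<in> the_cycle G" for a b
    using edge[OF that] cycle_edge_vertices[OF that] by blast
  moreover have "degree G w \<le> (if w = y then 3 else 2)" if "w \<in> W" for w
    using that Y(1,2) unfolding W_def by auto
  ultimately have "obstruction W" unfolding obstruction_def W_def by blast
  then show ?thesis unfolding W_def by blast
qed

lemma cycle_vertex_neighborE:
  assumes "v \<in> cycle_vertices G"
  obtains w where "{v, w} \<in> the_cycle G"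
proof -
  have "cycle_neighbors G v \<noteq> {}" using card_cycle_neighbors[OF assms] by auto
  then show ?thesis using that unfolding cycle_neighbors_def by blast
qed

lemma cycle_neighbors_eq:
  assumes "{v, a} \<in> the_cycle G" "{v, b} \<in> the_cycle G" "a \<noteq> b"
  shows "cycle_neighbors G v = {a, b}"
proof -
  have "v \<in> cycle_vertices G" using assms(1) cycle_edge_vertices by blast
  then have "card (cycle_neighbors G v) = 2" by (rule card_cycle_neighbors)
  moreover have "{a, b} \<subseteq> cycle_neighbors G v" using assms unfolding cycle_neighbors_def by blast
  ultimately show ?thesis using assms(3) by (metis card_2_iff card_ge_0_finite card_subset_eq pos2)
qed

lemma no_obstruction_if:
  assumes "two_disjoint_branching_pairs G \<or> heavy_cycle_vertex G"
  shows "\<not> obstruction W"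
proof
  assume W: "obstruction W"
  from assms show False
  proof
    assume "two_disjoint_branching_pairs G"
    then obtain u v x y where C: "{u, v, x, y} \<subseteq> cycle_vertices G"
      and arcs: "(u, v) \<in> parcs G" "(x, y) \<in> parcs G"
      and disj: "{u, v} \<inter> {x, y} = {}" and deg: "\<forall>w \<in> {u, v, x, y}. 3 \<le> degree G w"
      unfolding two_disjoint_branching_pairs_def by (elim exE conjE) (rule that)
    have "{u, v} \<in> the_cycle G" "{x, y} \<in> the_cycle G"
      using chordless[OF _ _ arcs(1)] chordless[OF _ _ arcs(2)] C by simp_all
    then have "u \<in> W \<or> v \<in> W" "x \<in> W \<or> y \<in> W"
      using obstruction_cover[OF W] by metis+
    then obtain a b where ab: "a \<in> {u, v}" "a \<in> W" "b \<in> {x, y}" "b \<in> W" by blast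
    then have "3 \<le> degree G a" "3 \<le> degree G b" using deg by auto
    then have "a = b" using obstruction_branching_unique[OF W ab(2,4)] by simp
    then show False using ab(1,3) disj by blast
  next
    assume "heavy_cycle_vertex G"
    then obtain v where v: "v \<in> cycle_vertices G" "4 \<le> degree G v"
      and nb: "(\<exists>w \<in> cycle_neighbors G v. 4 \<le> degree G w) \<or> (\<forall>w \<in> cycle_neighbors G v. degree G w = 3)"
      unfolding heavy_cycle_vertex_def by blast
    have "v \<notin> W" using v(2) obstruction_degree_le[OF W, of v] by linarith
    then have inW: "w \<in> W" if "w \<in> cycle_neighbors G v" for w
      using that obstruction_cover[OF W] unfolding cycle_neighbors_def by blast
    obtain a b where ab: "cycle_neighbors G v = {a, b}" "a \<noteq> b"
      using card_cycle_neighbors[OF v(1)] by (auto simp: card_2_iff)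
    from nb show False
    proof
      assume "\<exists>w \<in> cycle_neighbors G v. 4 \<le> degree G w"
      then obtain w where "w \<in> W" "4 \<le> degree G w" using inW by blast
      then show False using obstruction_degree_le[OF W, of w] by linarith
    next
      assume "\<forall>w \<in> cycle_neighbors G v. degree G w = 3"
      then show False using obstruction_branching_unique[OF W, of a b] inW ab by simp
    qed
  qed
qed

text \<open>
  Edges between branching cycle vertices pairwise intersect, hence all of them share a vertex,
  as there are no triangles. If there are at least two, their common vertex has degree three: were
  it of larger degree, both its cycle neighbours would be of degree three, or one of them of larger
  degree, and either makes it heavy. If there is only one, its ends cannot both
  have larger degree. So in each case a vertex of degree three covers all these edges.
\<close>
lemma ex_obstruction_if:
  assumes pairs: "\<not> two_disjoint_branching_pairs G" and heavy: "\<not> heavy_cycle_vertex G"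
  shows "\<exists>W. obstruction W"
proof -
  define H where "H a b \<longleftrightarrow> {a, b} \<in> the_cycle G \<and> 3 \<le> degree G a \<and> 3 \<le> degree G b" for a b
  have H_sym: "H b a" if "H a b" for a b using that unfolding H_def by (simp add: insert_commute)
  have meet: "x = u \<or> x = v \<or> y = u \<or> y = v" if "H u v" "H x y" for u v x y
  proof (rule ccontr)
    assume "\<not> ?thesis"
    then have disj: "{u, v} \<inter> {x, y} = {}" by blast
    have C: "{u, v, x, y} \<subseteq> cycle_vertices G"
      using that cycle_edge_vertices[of u v] cycle_edge_vertices[of x y] unfolding H_def by simp
    have arcs: "(u, v) \<in> parcs G" "(x, y) \<in> parcs G" and deg: "\<forall>w \<in> {u, v, x, y}. 3 \<le> degree G w"
      using that cycle_edge_arc unfolding H_def by simp_all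
    have "two_disjoint_branching_pairs G"
      unfolding two_disjoint_branching_pairs_def
      by (intro exI[of _ u] exI[of _ v] exI[of _ x] exI[of _ y] conjI C arcs disj deg)
    with pairs show False by contradiction
  qed
  have not_both: "degree G v \<le> 3" if "H u v" "4 \<le> degree G u" for u v
  proof (rule ccontr)
    assume "\<not> degree G v \<le> 3"
    then have "v \<in> cycle_neighbors G u" "4 \<le> degree G v" "u \<in> cycle_vertices G"
      using that cycle_edge_vertices unfolding H_def cycle_neighbors_def by auto
    then show False using heavy that(2) unfolding heavy_cycle_vertex_def by blast
  qed
  have center: "degree G v \<le> 3" if "H v a" "H v b" "a \<noteq> b" for v a b
  proof (rule ccontr)
    assume "\<not> degree G v \<le> 3"
    then have d: "4 \<le> degree G v" by simp
    then have "degree G a = 3" "degree G b = 3"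
      using not_both[OF that(1)] not_both[OF that(2)] that unfolding H_def by auto
    moreover have "cycle_neighbors G v = {a, b}"
      using that cycle_neighbors_eq unfolding H_def by blast
    ultimately have "\<forall>w \<in> cycle_neighbors G v. degree G w = 3" by simp
    moreover have "v \<in> cycle_vertices G" using that(1) cycle_edge_vertices unfolding H_def by blast
    ultimately show False using heavy d unfolding heavy_cycle_vertex_def by blast
  qed
  have share: "x = v \<or> y = v" if "H v a" "H v b" "a \<noteq> b" "H x y" for v a b x y
  proof (rule ccontr)
    assume "\<not> ?thesis"
    then have "{x, y} = {a, b}" using meet[OF that(1) that(4)] meet[OF that(2) that(4)] that(3) by blast
    then have "{a, b} \<in> the_cycle G" using that(4) unfolding H_def by simp
    then show False
      using that(1,2) no_triangle[of v a b] cycle_edge_arc arcs_symmetric unfolding H_def by blast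
  qed
  have "\<exists>Y y. Y \<subseteq> {y} \<and> (y \<in> Y \<longrightarrow> degree G y \<le> 3) \<and> (\<forall>a b. H a b \<longrightarrow> a \<in> Y \<or> b \<in> Y)"
  proof (cases "\<exists>v a b. H v a \<and> H v b \<and> a \<noteq> b")
    case True
    then obtain v a b where v: "H v a" "H v b" "a \<noteq> b" by blast
    have "\<forall>x y. H x y \<longrightarrow> x \<in> {v} \<or> y \<in> {v}" using share[OF v] by blast
    then show ?thesis using center[OF v] by blast
  next
    case single: False
    show ?thesis
    proof (cases "\<exists>u v. H u v")
      case True
      then obtain a b where ab: "H a b" by blast
      obtain u v where uv: "H u v" "degree G v \<le> 3"
        using that[OF ab] that[OF H_sym[OF ab]] not_both[OF ab] by linarith
      have "x = v \<or> y = v" if "H x y" for x y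
        using meet[OF uv(1) that] single uv(1) that H_sym by metis
      then show ?thesis using uv(2) by blast
    next
      case False
      then show ?thesis by blast
    qed
  qed
  then obtain Y y where "Y \<subseteq> {y}" "y \<in> Y \<Longrightarrow> degree G y \<le> 3" "\<And>a b. H a b \<Longrightarrow> a \<in> Y \<or> b \<in> Y"
    by blast
  then show ?thesis using ex_obstruction_avoiding[of Y y "{}"] unfolding H_def by auto
qed

lemma graph_dist_le_length:
  assumes "awalk u p v"
  shows "graph_dist G u v \<le> ereal (real (length p))"
proof -
  have "awalk_cost (\<lambda>_. 1) p = real (length p)"
    by (induction p) (simp_all add: awalk_cost_def)
  then show ?thesis using min_cost_le_walk_cost[OF assms, of "\<lambda>_. 1"] unfolding graph_dist_def by simp
qed

lemma graph_dist_ge_3D: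
  assumes "3 \<le> graph_dist G u v"
  shows "(u, v) \<notin> parcs G" and "(u, x) \<in> parcs G \<Longrightarrow> (x, v) \<notin> parcs G"
proof -
  show "(u, v) \<notin> parcs G"
  proof
    assume uv: "(u, v) \<in> parcs G"
    then have "awalk u [(u, v)] v" unfolding awalk_def using in_arcsD1 by auto
    then have "3 \<le> ereal (real (length [(u, v)]))" using graph_dist_le_length assms order_trans by blast
    then show False by simp
  qed
  show "(x, v) \<notin> parcs G" if ux: "(u, x) \<in> parcs G"
  proof
    assume xv: "(x, v) \<in> parcs G"
    have "awalk u [(u, x), (x, v)] v" unfolding awalk_def using ux xv in_arcsD1 by auto
    then have "3 \<le> ereal (real (length [(u, x), (x, v)]))"
      using graph_dist_le_length assms order_trans by blast
    then show False by simp
  qed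
qed

lemma graph_dist_less_3D:
  assumes "\<not> 3 \<le> graph_dist G u v" "u \<noteq> v"
  shows "(u, v) \<in> parcs G \<or> (\<exists>x. (u, x) \<in> parcs G \<and> (x, v) \<in> parcs G)"
proof -
  obtain p where p: "awalk u p v" "\<not> 3 \<le> ereal (awalk_cost (\<lambda>_. 1) p)"
    using assms(1) unfolding graph_dist_def \<mu>_def by (auto simp: le_INF_iff)
  have "awalk_cost (\<lambda>_. 1) p = real (length p)"
    by (induction p) (simp_all add: awalk_cost_def)
  then have "length p < 3" using p(2) by simp
  moreover have "p \<noteq> []" using p(1) assms(2) unfolding awalk_def by auto
  ultimately consider e where "p = [e]" | e f where "p = [e, f]"
    by (cases p rule: list.exhaust; cases "tl p") (auto simp: less_Suc_eq numeral_3_eq_3)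
  then show ?thesis
  proof cases
    case 1
    then show ?thesis using p(1) unfolding awalk_def by (cases e) auto
  next
    case 2
    then show ?thesis using p(1) unfolding awalk_def by (cases e; cases f) auto
  qed
qed

text \<open>
  Consider the cycle edges whose ends are branching or equal to \<open>x\<close>. If the branching vertices are
  far apart, at most one of them is next to \<open>x\<close>. If there are just two and they are adjacent, the
  only other such edge joins \<open>x\<close> to one of them, for want of triangles. In both cases some branching
  vertex other than \<open>x\<close> lies on all these edges, if there are any, and it may stay white.
\<close>
lemma every_vertex_avoidable_if:
  assumes "single_adjacent_branching_pair G \<or> far_apart_branching G"
  shows "\<exists>W. obstruction W \<and> W \<inter> {x} = {}"
  using assms
proof
  assume "single_adjacent_branching_pair G"
  then obtain u v where uv: "u \<noteq> v" "{w \<in> cycle_vertices G. degree G w = 3} = {u, v}"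
    "(u, v) \<in> parcs G" "\<forall>w \<in> cycle_vertices G - {u, v}. degree G w = 2"
    unfolding single_adjacent_branching_pair_def by (elim exE conjE) (rule that)
  have uC: "u \<in> cycle_vertices G" "v \<in> cycle_vertices G" "degree G u = 3" "degree G v = 3"
    using eqset_imp_iff[OF uv(2), of u] eqset_imp_iff[OF uv(2), of v] by simp_all
  have blue: "a \<in> {u, v, x}" if "a \<in> cycle_vertices G" "3 \<le> degree G a \<or> a \<in> {x}" for a
    using that uv(4) by fastforce
  have edge: "a \<in> {u, v, x}" "b \<in> {u, v, x}" "a \<noteq> b"
    if "{a, b} \<in> the_cycle G" "3 \<le> degree G a \<or> a \<in> {x}" "3 \<le> degree G b \<or> b \<in> {x}" for a b
    using blue[of a] blue[of b] that(2,3) cycle_edge_vertices[OF that(1)] cycle_edge_distinct[OF that(1)]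
    by simp_all
  have "{u, v} \<in> the_cycle G" using chordless[OF uC(1,2) uv(3)] .
  \<comment> \<open>If \<open>x\<close> is next to a branching vertex, that vertex has to stay white.\<close>
  show ?thesis
  proof (cases "{u, x} \<in> the_cycle G")
    case True
    have "{v, x} \<notin> the_cycle G"
      using no_triangle[OF uv(3) cycle_edge_arc arcs_symmetric[OF cycle_edge_arc[OF True]]] by blast
    have "a \<in> {u} \<or> b \<in> {u}"
      if "{a, b} \<in> the_cycle G" "3 \<le> degree G a \<or> a \<in> {x}" "3 \<le> degree G b \<or> b \<in> {x}" for a b
    proof (rule ccontr)
      assume "\<not> ?thesis"
      then have "{a, b} = {v, x}" using edge[OF that] by auto
      then show False using that(1) \<open>{v, x} \<notin> the_cycle G\<close> by simp
    qed
    moreover have "x \<noteq> u" using True cycle_edge_distinct by blast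
    ultimately show ?thesis
      using ex_obstruction_avoiding[of "{u}" u "{x}"] uC(3) by simp
  next
    case False
    have "a \<in> {v} \<or> b \<in> {v}"
      if "{a, b} \<in> the_cycle G" "3 \<le> degree G a \<or> a \<in> {x}" "3 \<le> degree G b \<or> b \<in> {x}" for a b
    proof (rule ccontr)
      assume "\<not> ?thesis"
      then have "{a, b} = {u, x}" using edge[OF that] by auto
      then show False using that(1) \<open>{u, x} \<notin> the_cycle G\<close> by simp
    qed
    moreover have "x \<noteq> v" using False \<open>{u, v} \<in> the_cycle G\<close> by blast
    ultimately show ?thesis
      using ex_obstruction_avoiding[of "{v}" v "{x}"] uC(4) by simp
  qed
next
  assume far: "far_apart_branching G"
  have le3: "degree G w \<le> 3" if "w \<in> cycle_vertices G" for w
    using far that unfolding far_apart_branching_def by blast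
  have dist: "3 \<le> graph_dist G a b"
    if "a \<in> cycle_vertices G" "b \<in> cycle_vertices G" "a \<noteq> b" "3 \<le> degree G a" "3 \<le> degree G b" for a b
    using far that le3[of a] le3[of b] unfolding far_apart_branching_def by force
  have no_edge: False if "{a, b} \<in> the_cycle G" "3 \<le> degree G a" "3 \<le> degree G b" for a b
    using dist[OF _ _ cycle_edge_distinct] that cycle_edge_vertices cycle_edge_arc graph_dist_ge_3D(1)
    by blast
  have one_near: "a = b" if "{x, a} \<in> the_cycle G" "{x, b} \<in> the_cycle G" "3 \<le> degree G a" "3 \<le> degree G b" for a b
    using dist[of a b] that cycle_edge_vertices cycle_edge_arc arcs_symmetric graph_dist_ge_3D(2) by blast
  define Y where "Y = {y. {x, y} \<in> the_cycle G \<and> 3 \<le> degree G y}"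
  obtain y where "Y \<subseteq> {y}" using one_near unfolding Y_def by blast
  moreover have "y \<in> Y \<Longrightarrow> degree G y \<le> 3"
    using le3 cycle_edge_vertices unfolding Y_def by blast
  moreover have "{x} \<inter> Y = {}" using cycle_edge_distinct unfolding Y_def by blast
  moreover have "a \<in> Y \<or> b \<in> Y"
    if ab: "{a, b} \<in> the_cycle G" "3 \<le> degree G a \<or> a \<in> {x}" "3 \<le> degree G b \<or> b \<in> {x}" for a b
  proof -
    have ne: "a \<noteq> b" using ab(1) cycle_edge_distinct by blast
    have ba: "{b, a} \<in> the_cycle G" using ab(1) by (simp add: insert_commute)
    consider "a = x" | "b = x" | "a \<noteq> x" "b \<noteq> x" by blast
    then show ?thesis
    proof cases
      case 1
      then show ?thesis using ab ne unfolding Y_def by blast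
    next
      case 2
      then show ?thesis using ab ba ne unfolding Y_def by blast
    next
      case 3
      then show ?thesis using no_edge[OF ab(1)] ab(2,3) by blast
    qed
  qed
  ultimately show ?thesis by (rule ex_obstruction_avoiding)
qed

text \<open>
  Two branching vertices with a common cycle neighbour cannot both be white, so a blue vertex
  between them settles the matter. So does a blue neighbour of a heavy vertex, and a blue vertex
  that completes two disjoint edges of blue vertices.
\<close>
lemma ex_vertex_meeting_all_obstructions:
  assumes "\<not> single_adjacent_branching_pair G" "\<not> far_apart_branching G"
  shows "\<exists>x \<in> cycle_vertices G. \<forall>W. obstruction W \<longrightarrow> x \<in> W"
proof (cases "\<exists>v \<in> cycle_vertices G. 4 \<le> degree G v")
  case True
  then obtain v where v: "v \<in> cycle_vertices G" "4 \<le> degree G v" by blast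
  obtain x where vx: "{v, x} \<in> the_cycle G" using v(1) by (rule cycle_vertex_neighborE)
  have "x \<in> W" if W: "obstruction W" for W
  proof -
    have "v \<notin> W" using v(2) obstruction_degree_le[OF W, of v] by linarith
    then show ?thesis using obstruction_cover[OF W vx] by blast
  qed
  then show ?thesis using vx cycle_edge_vertices by blast
next
  case False
  then have le3: "degree G w \<le> 3" if "w \<in> cycle_vertices G" for w
    using that by (auto simp: not_le)
  then obtain u v where uvC: "u \<in> cycle_vertices G" "v \<in> cycle_vertices G" and "u \<noteq> v"
    and du: "degree G u = 3" and dv: "degree G v = 3" and near: "\<not> 3 \<le> graph_dist G u v"
    using assms(2) unfolding far_apart_branching_def by blast
  have between: "\<exists>x \<in> cycle_vertices G. \<forall>W. obstruction W \<longrightarrow> x \<in> W"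
    if e: "{m, a} \<in> the_cycle G" "{m, b} \<in> the_cycle G" and "a \<noteq> b" "degree G a = 3" "degree G b = 3"
    for m a b
  proof (rule bexI[of _ m], intro allI impI)
    fix W assume W: "obstruction W"
    show "m \<in> W"
      using obstruction_cover[OF W e(1)] obstruction_cover[OF W e(2)]
        obstruction_branching_unique[OF W, of a b] that(3-5) by auto
  next
    show "m \<in> cycle_vertices G" using e(1) cycle_edge_vertices by blast
  qed
  consider m where "(u, m) \<in> parcs G" "(m, v) \<in> parcs G" | "(u, v) \<in> parcs G"
    using graph_dist_less_3D[OF near \<open>u \<noteq> v\<close>] by blast
  then show ?thesis
  proof cases
    case 1
    then have "m \<in> cycle_vertices G" using common_neighbor_on_cycle uvC \<open>u \<noteq> v\<close> by blast
    then have "{m, u} \<in> the_cycle G" "{m, v} \<in> the_cycle G"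
      using chordless uvC 1 arcs_symmetric by blast+
    then show ?thesis using between \<open>u \<noteq> v\<close> du dv by blast
  next
    case 2
    then have uv: "{u, v} \<in> the_cycle G" using chordless uvC by blast
    have "\<exists>w \<in> cycle_vertices G. w \<noteq> u \<and> w \<noteq> v \<and> degree G w = 3"
    proof (rule ccontr)
      assume "\<not> ?thesis"
      then have only: "w = u \<or> w = v" if "w \<in> cycle_vertices G" "degree G w = 3" for w
        using that by blast
      then have all: "{w \<in> cycle_vertices G. degree G w = 3} = {u, v}" using uvC du dv by auto
      have rest: "degree G w = 2" if "w \<in> cycle_vertices G - {u, v}" for w
      proof -
        have "degree G w \<noteq> 3" using only that by blast
        then show ?thesis using le3[of w] two_le_degree_cycle[of w] that by simp
      qed
      have "single_adjacent_branching_pair G"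
        unfolding single_adjacent_branching_pair_def
        by (intro exI[of _ u] exI[of _ v] conjI ballI \<open>u \<noteq> v\<close> all 2 rest)
      with assms(1) show False by contradiction
    qed
    then obtain w where w: "w \<in> cycle_vertices G" "w \<noteq> u" "w \<noteq> v" "degree G w = 3" by blast
    show ?thesis
    proof (cases "{w, u} \<in> the_cycle G \<or> {w, v} \<in> the_cycle G")
      case True
      then show ?thesis
      proof
        assume "{w, u} \<in> the_cycle G"
        then have "{u, w} \<in> the_cycle G" by (simp add: insert_commute)
        then show ?thesis using between[of u w v] uv w(3,4) dv by blast
      next
        assume "{w, v} \<in> the_cycle G"
        then have "{v, w} \<in> the_cycle G" "{v, u} \<in> the_cycle G" using uv by (simp_all add: insert_commute)
        then show ?thesis using between[of v w u] w(2,4) du by blast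
      qed
    next
      case False
      obtain x where x: "{w, x} \<in> the_cycle G" using w(1) by (rule cycle_vertex_neighborE)
      have "x \<in> W" if W: "obstruction W" for W
      proof (rule ccontr)
        assume "x \<notin> W"
        then have "w \<in> W" using W x unfolding obstruction_def by blast
        moreover obtain z where "z \<in> W" "z = u \<or> z = v" using obstruction_cover[OF W uv] by blast
        moreover have "3 \<le> degree G z" using \<open>z = u \<or> z = v\<close> du dv by auto
        ultimately have "w = z" using obstruction_branching_unique[OF W, of w z] w(4) by simp
        then show False using \<open>z = u \<or> z = v\<close> w(2,3) by blast
      qed
      then show ?thesis using x cycle_edge_vertices by blast
    qed
  qed
qed

section \<open>The leaky forcing number\<close>

definition leaves :: "'a set" where
  "leaves = {v \<in> pverts G. degree G v = 1}"

lemma finite_leaves: "finite leaves"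
  unfolding leaves_def using pair_finite_verts by simp

lemma leaves_disjoint_cycle: "leaves \<inter> cycle_vertices G = {}"
  unfolding leaves_def using two_le_degree_cycle by fastforce

lemma leaves_Un_forcing_iff:
  assumes "X \<subseteq> cycle_vertices G"
  shows "leaky_forcing_set G 1 (leaves \<union> X) \<longleftrightarrow> (\<forall>W. obstruction W \<longrightarrow> W \<inter> X \<noteq> {})"
proof -
  have sub: "leaves \<union> X \<subseteq> pverts G"
    using assms cycle_vertices_subset unfolding leaves_def by blast
  have "W \<inter> (leaves \<union> X) = W \<inter> X" if "obstruction W" for W
    using obstruction_subset[OF that] leaves_disjoint_cycle by blast
  then show ?thesis using leaky_forcing_set_iff[OF sub] unfolding leaves_def by auto
qed

lemma card_leaves_Un:
  assumes "X \<subseteq> cycle_vertices G"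
  shows "card (leaves \<union> X) = card leaves + card X"
  using assms finite_leaves finite_cycle_vertices leaves_disjoint_cycle finite_subset
  by (intro card_Un_disjoint) blast+

lemma leaky_forcing_number_eqI:
  assumes "leaky_forcing_set G 1 S" "card S = k"
    and "\<And>T. leaky_forcing_set G 1 T \<Longrightarrow> k \<le> card T"
  shows "leaky_forcing_number G 1 = k"
  unfolding leaky_forcing_number_def using assms by (intro Least_equality) blast+

lemma leaves_subset_forcing: "leaky_forcing_set G 1 T \<Longrightarrow> leaves \<subseteq> T \<and> finite T"
  using leaf_in_leaky_forcing_set pair_finite_verts finite_subset
  unfolding leaves_def leaky_forcing_set_def by blast

lemma leaky_forcing_number_eq_leaves:
  assumes "\<And>W. \<not> obstruction W"
  shows "leaky_forcing_number G 1 = card leaves"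
proof (rule leaky_forcing_number_eqI)
  show "leaky_forcing_set G 1 leaves" using leaves_Un_forcing_iff[of "{}"] assms by simp
  show "card leaves \<le> card T" if "leaky_forcing_set G 1 T" for T
    using leaves_subset_forcing[OF that] by (simp add: card_mono)
qed simp

lemma leaky_forcing_number_eq_leaves_plus_1:
  assumes "\<exists>W. obstruction W"
    and "x \<in> cycle_vertices G" "\<And>W. obstruction W \<Longrightarrow> x \<in> W"
  shows "leaky_forcing_number G 1 = card leaves + 1"
proof (rule leaky_forcing_number_eqI)
  have "W \<inter> {x} \<noteq> {}" if "obstruction W" for W using assms(3)[OF that] by simp
  then show "leaky_forcing_set G 1 (leaves \<union> {x})"
    using leaves_Un_forcing_iff[of "{x}"] assms(2) by simp
  show "card (leaves \<union> {x}) = card leaves + 1" using card_leaves_Un[of "{x}"] assms(2) by simp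
  show "card leaves + 1 \<le> card T" if T: "leaky_forcing_set G 1 T" for T
  proof -
    have "T \<noteq> leaves" using T leaves_Un_forcing_iff[of "{}"] assms(1) by auto
    then have "leaves \<subset> T" using leaves_subset_forcing[OF T] by blast
    then have "card leaves < card T"
      using leaves_subset_forcing[OF T] by (intro psubset_card_mono) simp_all
    then show ?thesis by simp
  qed
qed

text \<open>
  Both ends of a cycle edge, together with the leaves, form a 1-leaky forcing set. A single vertex
  besides the leaves is not enough: by assumption, an obstruction avoids it.
\<close>
lemma leaky_forcing_number_eq_leaves_plus_2:
  assumes avoid: "\<And>x. \<exists>W. obstruction W \<and> W \<inter> {x} = {}"
  shows "leaky_forcing_number G 1 = card leaves + 2"
proof -
  obtain a b where ab: "{a, b} \<in> the_cycle G" using ex_cycle_edge by blast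
  then have C: "{a, b} \<subseteq> cycle_vertices G" using cycle_edge_vertices by blast
  show ?thesis
  proof (rule leaky_forcing_number_eqI)
    have "W \<inter> {a, b} \<noteq> {}" if "obstruction W" for W using obstruction_cover[OF that ab] by blast
    then show "leaky_forcing_set G 1 (leaves \<union> {a, b})" using leaves_Un_forcing_iff[OF C] by blast
    show "card (leaves \<union> {a, b}) = card leaves + 2"
      using card_leaves_Un[OF C] cycle_edge_distinct[OF ab] by simp
    show "card leaves + 2 \<le> card T" if T: "leaky_forcing_set G 1 T" for T
    proof (rule ccontr)
      assume "\<not> card leaves + 2 \<le> card T"
      moreover have LT: "leaves \<subseteq> T" "finite T" using leaves_subset_forcing[OF T] by blast+
      ultimately have "card (T - leaves) \<le> 1" using finite_leaves by (simp add: card_Diff_subset)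
      then have "card (T - leaves) = 0 \<or> card (T - leaves) = 1" by linarith
      then obtain x where x: "T - leaves \<subseteq> {x}" using LT(2) by (auto simp: card_1_singleton_iff)
      obtain W where W: "obstruction W" "W \<inter> {x} = {}" using avoid by blast
      have "W \<inter> T = {}"
        using W x obstruction_subset[OF W(1)] leaves_disjoint_cycle by blast
      moreover have "T \<subseteq> pverts G" using T unfolding leaky_forcing_set_def by blast
      ultimately show False using T W(1) leaky_forcing_set_iff[of T] by simp
    qed
  qed
qed

end

theorem theorem3p7:
  fixes G :: "'a pair_pre_digraph" and Q :: "'a set" and q :: nat
  assumes "pair_graph G"
    and "unicyclic G"
    and "unicyclic_girth G \<ge> 4"
    and "Q = {v \<in> pverts G. degree G v = 1}"
    and "q = card Q"
  shows "(two_disjoint_branching_pairs G \<or> heavy_cycle_vertex G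
            \<longrightarrow> leaky_forcing_number G 1 = q) \<and>
         (single_adjacent_branching_pair G \<or> far_apart_branching G
            \<longrightarrow> leaky_forcing_number G 1 = q + 2) \<and>
         (\<not> (two_disjoint_branching_pairs G \<or> heavy_cycle_vertex G) \<and>
          \<not> (single_adjacent_branching_pair G \<or> far_apart_branching G)
            \<longrightarrow> leaky_forcing_number G 1 = q + 1)"
proof -
  interpret unicyclic_girth_ge_4 G
    using assms(1-3) by (intro unicyclic_girth_ge_4.intro unicyclic_girth_ge_4_axioms.intro)
  have q: "q = card leaves" unfolding leaves_def assms(4,5) ..
  show ?thesis
    unfolding q
  proof (intro conjI impI)
    assume "two_disjoint_branching_pairs G \<or> heavy_cycle_vertex G"
    then show "leaky_forcing_number G 1 = card leaves"
      using leaky_forcing_number_eq_leaves no_obstruction_if by blast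
  next
    assume "single_adjacent_branching_pair G \<or> far_apart_branching G"
    then show "leaky_forcing_number G 1 = card leaves + 2"
      using leaky_forcing_number_eq_leaves_plus_2 every_vertex_avoidable_if by blast
  next
    assume "\<not> (two_disjoint_branching_pairs G \<or> heavy_cycle_vertex G) \<and>
      \<not> (single_adjacent_branching_pair G \<or> far_apart_branching G)"
    then show "leaky_forcing_number G 1 = card leaves + 1"
      using leaky_forcing_number_eq_leaves_plus_1 ex_obstruction_if
        ex_vertex_meeting_all_obstructions by blast
  qed
qed

end
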